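(* Let $b\in\mathbb{R}$ and define, for $\zeta\in\mathbb{R}$, $$\mathrm{Hi}_b(\zeta):=\frac1\pi\int_0^\infty\exp\left(\zeta u-\tfrac12b^2u^2-\tfrac13u^3\right)du.$$ Then $$\mathrm{Hi}_b(\zeta)=\mathrm{Bi}_{ib}(\zeta)\int_{-\infty}^\zeta\mathrm{Ai}_b(t)\,dt-\mathrm{Ai}_{ib}(\zeta)\int_{-\infty}^\zeta\mathrm{Bi}_b(t)\,dt.$$
   Context: $\mathrm{Ai}$ and $\mathrm{Bi}$ are the two standard solutions of the Airy equation $y''=xy$. For a complex parameter $b$, $$\mathrm{Ai}_b(\zeta)=e^{\frac{b^2\zeta}{2}+\frac{b^6}{12}}\mathrm{Ai}\left(\zeta+\frac{b^4}{4}\right),\qquad\mathrm{Bi}_b(\zeta)=e^{\frac{b^2\zeta}{2}+\frac{b^6}{12}}\mathrm{Bi}\left(\zeta+\frac{b^4}{4}\right).$$ In particular, with $i=\sqrt{-1}$ and $b$ real, $\mathrm{Ai}_{ib}(\zeta)=e^{-\frac{b^2\zeta}{2}-\frac{b^6}{12}}\mathrm{Ai}\left(\zeta+\frac{b^4}{4}\right)$, and likewise for $\mathrm{Bi}_{ib}$. The integrals from $-\infty$ are understood as improper integrals $\lim_{R\to\infty}\int_{-R}^\zeta$ (they converge only conditionally when $b=0$). *)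

theory Defs
  imports "HOL-Analysis.Analysis"
begin

definition airy_ivp :: "complex \<Rightarrow> complex \<Rightarrow> (complex \<Rightarrow> complex) \<Rightarrow> bool" where
  "airy_ivp c d y \<longleftrightarrow>
     (\<exists>y'. (\<forall>z. (y has_field_derivative y' z) (at z)) \<and>
           (\<forall>z. (y' has_field_derivative z * y z) (at z)) \<and>
           y 0 = c \<and> y' 0 = d)"

fun airy_coeff :: "complex \<Rightarrow> complex \<Rightarrow> nat \<Rightarrow> complex" where
  "airy_coeff c d 0 = c"
| "airy_coeff c d (Suc 0) = d"
| "airy_coeff c d (Suc (Suc 0)) = 0"
| "airy_coeff c d (Suc (Suc (Suc n))) = airy_coeff c d n / (of_nat (n + 2) * of_nat (n + 3))"

lemma summable_airy_coeff: "summable (\<lambda>n. airy_coeff c d n * z ^ n)"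
proof -
  define K where "K = 2 * norm z + 1"
  have K: "K > 0" by (simp add: K_def add_nonneg_pos)
  define g where "g n = norm (airy_coeff c d n) * K ^ n" for n
  obtain N :: nat where N: "K ^ 3 \<le> of_nat N" using real_arch_simple by blast
  define M where "M = Max (g ` {..N + 3})"
  have gM: "g n \<le> M" if "n \<le> N + 3" for n
    unfolding M_def using that by (intro Max_ge) auto
  have g: "g n \<le> M" for n
  proof (induction n rule: less_induct)
    case (less n)
    show ?case
    proof (cases "n \<le> N + 3")
      case False
      define m where "m = n - 3"
      have m: "n = Suc (Suc (Suc m))" "N \<le> m" using False by (simp_all add: m_def)
      have "K ^ 3 \<le> real (m + 2) * 1" using N m(2) by simp
      also have "\<dots> \<le> real (m + 2) * real (m + 3)" by (intro mult_left_mono) auto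
      finally have le: "K ^ 3 / (real (m + 2) * real (m + 3)) \<le> 1" by (simp add: divide_le_eq)
      have "g n = g m * (K ^ 3 / (real (m + 2) * real (m + 3)))"
        unfolding g_def m(1) airy_coeff.simps norm_divide norm_mult norm_of_nat
        by (simp add: power3_eq_cube)
      also have "\<dots> \<le> g m * 1"
        using K by (intro mult_left_mono le) (simp add: g_def)
      also have "\<dots> \<le> M" using less m(1) by simp
      finally show ?thesis .
    qed (use gM in auto)
  qed
  show ?thesis
  proof (rule summable_comparison_test'[where N = 0])
    show "summable (\<lambda>n. M * (1 / 2) ^ n)" by (intro summable_mult summable_geometric) auto
    fix n :: nat
    have "norm z ^ n \<le> (K * (1 / 2)) ^ n" by (intro power_mono) (auto simp: K_def)
    then have "norm (airy_coeff c d n * z ^ n) \<le> norm (airy_coeff c d n) * (K * (1 / 2)) ^ n"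
      by (simp add: norm_mult norm_power mult_left_mono)
    also have "\<dots> = g n * (1 / 2) ^ n" by (simp only: g_def power_mult_distrib mult.assoc)
    also have "\<dots> \<le> M * (1 / 2) ^ n" by (intro mult_right_mono g) auto
    finally show "norm (airy_coeff c d n * z ^ n) \<le> M * (1 / 2) ^ n" .
  qed
qed

lemma airy_ivp_series: "airy_ivp c d (\<lambda>z. \<Sum>n. airy_coeff c d n * z ^ n)"
proof -
  let ?a = "airy_coeff c d"
  have s: "summable (\<lambda>n. ?a n * z ^ n)" for z by (rule summable_airy_coeff)
  have s1: "summable (\<lambda>n. diffs ?a n * z ^ n)" for z by (rule termdiff_converges_all[OF s])
  have s2: "summable (\<lambda>n. diffs (diffs ?a) n * z ^ n)" for z
    by (rule termdiff_converges_all[OF s1])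
  have d0: "diffs (diffs ?a) 0 = 0" by (simp add: diffs_def)
  have d1: "diffs (diffs ?a) (Suc n) = ?a n" for n
  proof -
    have "(of_nat (n + 2) :: complex) \<noteq> 0" "(of_nat (n + 3) :: complex) \<noteq> 0"
      by (simp_all only: of_nat_eq_0_iff)
    moreover have "diffs (diffs ?a) (Suc n) =
        of_nat (n + 2) * (of_nat (n + 3) * (?a n / (of_nat (n + 2) * of_nat (n + 3))))"
      by (simp add: diffs_def numeral_3_eq_3)
    ultimately show ?thesis by (simp del: of_nat_add)
  qed
  have eq: "(\<Sum>n. diffs (diffs ?a) n * z ^ n) = z * (\<Sum>n. ?a n * z ^ n)" for z
  proof -
    have "(\<Sum>n. diffs (diffs ?a) n * z ^ n) = (\<Sum>n. diffs (diffs ?a) (Suc n) * z ^ Suc n)"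
      using suminf_split_head[OF s2[of z]] by (simp add: d0)
    also have "\<dots> = (\<Sum>n. z * (?a n * z ^ n))" by (simp add: d1 mult_ac)
    also have "\<dots> = z * (\<Sum>n. ?a n * z ^ n)" by (rule suminf_mult[OF s])
    finally show ?thesis .
  qed
  have "((\<lambda>z. \<Sum>n. ?a n * z ^ n) has_field_derivative (\<Sum>n. diffs ?a n * z ^ n)) (at z)" for z
    by (rule termdiffs_strong_converges_everywhere[OF s])
  moreover have "((\<lambda>z. \<Sum>n. diffs ?a n * z ^ n) has_field_derivative
                   z * (\<Sum>n. ?a n * z ^ n)) (at z)" for z
    using termdiffs_strong_converges_everywhere[OF s1, of z] unfolding eq .
  ultimately show ?thesis
    unfolding airy_ivp_def
    by (intro exI[of _ "\<lambda>z. \<Sum>n. diffs ?a n * z ^ n"] conjI allI) (auto simp: diffs_def)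
qed

lemma airy_ivp_unique:
  assumes "airy_ivp c d f" "airy_ivp c d g"
  shows "f = g"
proof
  fix z
  have wronskian: "p z * q' z - p' z * q z = p 0 * q' 0 - p' 0 * q 0"
    if "\<And>z. (p has_field_derivative p' z) (at z)" "\<And>z. (p' has_field_derivative z * p z) (at z)"
       "\<And>z. (q has_field_derivative q' z) (at z)" "\<And>z. (q' has_field_derivative z * q z) (at z)"
    for p p' q q' :: "complex \<Rightarrow> complex" and z
  proof -
    have "((\<lambda>z. p z * q' z - p' z * q z) has_field_derivative 0) (at x)" for x
      by (rule derivative_eq_intros that refl | simp add: algebra_simps)+
    then show ?thesis
      using has_field_derivative_zero_constant[of UNIV "\<lambda>z. p z * q' z - p' z * q z"]
      by (metis UNIV_I convex_UNIV)
  qed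
  obtain f' where f: "\<And>z. (f has_field_derivative f' z) (at z)"
    "\<And>z. (f' has_field_derivative z * f z) (at z)" "f 0 = c" "f' 0 = d"
    using assms(1) unfolding airy_ivp_def by blast
  obtain g' where g: "\<And>z. (g has_field_derivative g' z) (at z)"
    "\<And>z. (g' has_field_derivative z * g z) (at z)" "g 0 = c" "g' 0 = d"
    using assms(2) unfolding airy_ivp_def by blast
  have "\<exists>u. airy_ivp 1 0 u" using airy_ivp_series by blast
  then obtain u u' :: "complex \<Rightarrow> complex" where u: "\<And>z. (u has_field_derivative u' z) (at z)"
    "\<And>z. (u' has_field_derivative z * u z) (at z)" "u 0 = 1" "u' 0 = 0"
    unfolding airy_ivp_def by blast
  have "\<exists>v. airy_ivp 0 1 v" using airy_ivp_series by blast
  then obtain v v' :: "complex \<Rightarrow> complex" where v: "\<And>z. (v has_field_derivative v' z) (at z)"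
    "\<And>z. (v' has_field_derivative z * v z) (at z)" "v 0 = 0" "v' 0 = 1"
    unfolding airy_ivp_def by blast
  have fu: "f z * u' z - f' z * u z = g z * u' z - g' z * u z"
    using wronskian[OF f(1,2) u(1,2), of z] wronskian[OF g(1,2) u(1,2), of z] f g by simp
  have fv: "f z * v' z - f' z * v z = g z * v' z - g' z * v z"
    using wronskian[OF f(1,2) v(1,2), of z] wronskian[OF g(1,2) v(1,2), of z] f g by simp
  have uv: "u z * v' z - u' z * v z = 1"
    using wronskian[OF u(1,2) v(1,2), of z] u v by simp
  have "f z = f z * (u z * v' z - u' z * v z)" by (simp add: uv)
  also have "\<dots> = u z * (f z * v' z - f' z * v z) - v z * (f z * u' z - f' z * u z)"
    by (simp add: algebra_simps)
  also have "\<dots> = u z * (g z * v' z - g' z * v z) - v z * (g z * u' z - g' z * u z)"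
    by (simp only: fu fv)
  also have "\<dots> = g z * (u z * v' z - u' z * v z)" by (simp add: algebra_simps)
  finally show "f z = g z" by (simp add: uv)
qed

lemma airy_ivp_ex1: "\<exists>!y. airy_ivp c d y"
  using airy_ivp_series airy_ivp_unique by blast

text \<open>
  \<open>Ai\<close> and \<open>Bi\<close> are the entire solutions of \<open>y'' = z y\<close> singled out by their classical
  values at the origin; existence and uniqueness are provided by \<open>airy_ivp_ex1\<close>.
\<close>

definition Airy_Ai :: "complex \<Rightarrow> complex" where
  "Airy_Ai = (THE y. airy_ivp (of_real (1 / (3 powr (2 / 3) * Gamma (2 / 3))))
                              (of_real (- 1 / (3 powr (1 / 3) * Gamma (1 / 3)))) y)"

definition Airy_Bi :: "complex \<Rightarrow> complex" where
  "Airy_Bi = (THE y. airy_ivp (of_real (1 / (3 powr (1 / 6) * Gamma (2 / 3))))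
                              (of_real (3 powr (1 / 6) / Gamma (1 / 3))) y)"

definition Ai_par :: "complex \<Rightarrow> complex \<Rightarrow> complex" where
  "Ai_par b \<zeta> = exp (b ^ 2 * \<zeta> / 2 + b ^ 6 / 12) * Airy_Ai (\<zeta> + b ^ 4 / 4)"

definition Bi_par :: "complex \<Rightarrow> complex \<Rightarrow> complex" where
  "Bi_par b \<zeta> = exp (b ^ 2 * \<zeta> / 2 + b ^ 6 / 12) * Airy_Bi (\<zeta> + b ^ 4 / 4)"

definition Hi_par :: "real \<Rightarrow> real \<Rightarrow> real" where
  "Hi_par b \<zeta> =
     1 / pi * integral {0..} (\<lambda>u. exp (\<zeta> * u - 1 / 2 * b ^ 2 * u ^ 2 - 1 / 3 * u ^ 3))"

lemma Hi_par_integrable: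
  "(\<lambda>u::real. exp (\<zeta> * u - 1 / 2 * b ^ 2 * u ^ 2 - 1 / 3 * u ^ 3)) integrable_on {0..}"
proof -
  let ?f = "\<lambda>u::real. exp (\<zeta> * u - 1 / 2 * b ^ 2 * u ^ 2 - 1 / 3 * u ^ 3)"
  define s where "s = \<bar>\<zeta>\<bar> + 1"
  have s: "s \<ge> 1" by (simp add: s_def)
  have bound: "?f u \<le> exp (3 * s ^ 2) * exp (- 1 * u)" if u: "u \<ge> 0" for u
  proof -
    have "s * u \<le> 3 * s ^ 2 + 1 / 3 * u ^ 3"
    proof (cases "u \<le> 3 * s")
      case True
      then have "s * u \<le> s * (3 * s)" using s by (intro mult_left_mono) auto
      then show ?thesis using u by (simp add: power2_eq_square add_increasing2)
    next
      case False
      then have "s \<le> 1 / 3 * u" "1 \<le> u" using s by auto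
      then have "s * u \<le> (1 / 3 * u) * u" by (intro mult_right_mono) auto
      also have "\<dots> \<le> (1 / 3 * u) * u * u" using \<open>1 \<le> u\<close> by (simp add: mult_le_cancel_left1)
      finally show ?thesis by (simp add: power3_eq_cube add_increasing)
    qed
    moreover have "\<zeta> * u \<le> \<bar>\<zeta>\<bar> * u" using u by (intro mult_right_mono) auto
    moreover have "0 \<le> 1 / 2 * b ^ 2 * u ^ 2" by simp
    moreover have "s * u = \<bar>\<zeta>\<bar> * u + u" by (simp add: s_def algebra_simps)
    ultimately have "\<zeta> * u - 1 / 2 * b ^ 2 * u ^ 2 - 1 / 3 * u ^ 3 \<le> 3 * s ^ 2 + - 1 * u"
      by linarith
    then show ?thesis by (simp only: exp_add[symmetric] exp_le_cancel_iff)
  qed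
  have dom: "(\<lambda>u::real. exp (3 * s ^ 2) * exp (- 1 * u)) integrable_on {0..}"
    using integrable_on_exp_minus_to_infinity[of 1 0]
    by (intro integrable_on_mult_right) (simp add: mult.commute)
  show ?thesis
  proof (rule measurable_bounded_by_integrable_imp_integrable[OF _ dom])
    show "?f \<in> borel_measurable (lebesgue_on {0..})"
      by (intro continuous_imp_measurable_on_sets_lebesgue continuous_intros) auto
  qed (use bound in auto)
qed

definition has_integral_from_minf :: "(real \<Rightarrow> complex) \<Rightarrow> complex \<Rightarrow> real \<Rightarrow> bool" where
  "has_integral_from_minf f I \<zeta> \<longleftrightarrow>
     (\<forall>a\<le>\<zeta>. f integrable_on {a..\<zeta>}) \<and>
     ((\<lambda>R. integral {-R..\<zeta>} f) \<longlongrightarrow> I) at_top"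

text \<open>The value of the improper integral is meaningful only when it converges.\<close>

definition integral_from_minf :: "(real \<Rightarrow> complex) \<Rightarrow> real \<Rightarrow> complex" where
  "integral_from_minf f \<zeta> = (THE I. has_integral_from_minf f I \<zeta>)"

lemma integral_from_minf_eq: "has_integral_from_minf f I \<zeta> \<Longrightarrow> integral_from_minf f \<zeta> = I"
  unfolding integral_from_minf_def has_integral_from_minf_def
  by (rule the_equality) (auto intro: tendsto_unique[OF trivial_limit_at_top_linorder])

end

theory Submission
  imports Defs
begin

text \<open>
  Let \<open>F = Hi\<^sub>b\<close>, let \<open>w\<close> be any solution of the Airy equation, and put
  \<open>g t = exp (b\<^sup>2 t / 2 + b\<^sup>6 / 12) w (t + b\<^sup>4 / 4)\<close> and \<open>h = g' - b\<^sup>2 g\<close>, so that \<open>h' = t g\<close>.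
  Since \<open>F'' + b\<^sup>2 F' - t F = 1 / \<pi>\<close>, we get \<open>(F' g - F h)' = g / \<pi>\<close>. At \<open>-\<infinity>\<close>
  the boundary term \<open>F' g - F h\<close> vanishes, because \<open>F = O(1 / \<bar>t\<bar>)\<close> and \<open>F' = O(1 / t\<^sup>2)\<close>, while
  the Airy energy \<open>w\<^sup>2 - w'\<^sup>2 / x\<close> is monotone on the negative axis, whence
  \<open>g = O(1)\<close> and \<open>h = O(\<bar>t\<bar>\<^sup>1\<^sup>/\<^sup>2)\<close>. Hence
  the integral of \<open>g\<close> over \<open>(-\<infinity>, \<zeta>]\<close> is \<open>\<pi> (F' g - F h) (\<zeta>)\<close>. Taking \<open>w = Ai\<close> and
  \<open>w = Bi\<close>, the terms with \<open>F'\<close> cancel in the asserted combination, and the Wronskian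
  \<open>1 / \<pi>\<close> leaves \<open>F\<close>. Differentiation under the integral sign is only done
  for the integral truncated to \<open>[0, N]\<close>.
\<close>

section \<open>The truncated moments\<close>

definition Hi_kernel :: "real \<Rightarrow> real \<Rightarrow> real \<Rightarrow> real" where
  "Hi_kernel b t u = exp (t * u - 1 / 2 * b ^ 2 * u ^ 2 - 1 / 3 * u ^ 3)"

text \<open>The index \<open>k\<close> counts the \<open>t\<close>-derivatives of the truncated
  integral of \<open>Hi_kernel\<close>; the cutoff \<open>N\<close> keeps the range of integration
  compact.\<close>

definition Hi_moment :: "nat \<Rightarrow> real \<Rightarrow> real \<Rightarrow> real \<Rightarrow> real" where
  "Hi_moment k b N t = integral {0..N} (\<lambda>u. u ^ k * Hi_kernel b t u)"

lemma Hi_kernel_nonneg: "Hi_kernel b t u \<ge> 0"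
  by (simp add: Hi_kernel_def)

lemma continuous_on_Hi_kernel [continuous_intros]:
  "continuous_on S p \<Longrightarrow> continuous_on S q \<Longrightarrow> continuous_on S (\<lambda>x. Hi_kernel b (p x) (q x))"
  unfolding Hi_kernel_def by (intro continuous_intros)

lemma Hi_kernel_moment_integrable:
  "(\<lambda>u. u ^ k * Hi_kernel b t u) integrable_on {x..y}"
  by (intro integrable_continuous_real continuous_intros)

lemma Hi_moment_nonneg: "Hi_moment k b N t \<ge> 0"
  unfolding Hi_moment_def
  by (intro integral_nonneg Hi_kernel_moment_integrable) (simp add: Hi_kernel_nonneg)

lemma Hi_moment_mono: "M \<le> N \<Longrightarrow> Hi_moment k b M t \<le> Hi_moment k b N t"
  unfolding Hi_moment_def
  by (intro integral_subset_le Hi_kernel_moment_integrable) (auto simp: Hi_kernel_nonneg)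

text \<open>Differentiating the kernel in \<open>t\<close> brings down a factor \<open>u\<close>; on
  a compact range, joint continuity of the result is enough for the Leibniz rule.\<close>

lemma has_real_derivative_Hi_moment:
  "(Hi_moment k b N has_real_derivative Hi_moment (Suc k) b N t) (at t)"
proof -
  have "((\<lambda>t. integral (cbox 0 N) (\<lambda>u. u ^ k * Hi_kernel b t u)) has_field_derivative
          integral (cbox 0 N) (\<lambda>u. u ^ Suc k * Hi_kernel b t u)) (at t within UNIV)"
  proof (rule leibniz_rule_field_derivative)
    show "((\<lambda>t. u ^ k * Hi_kernel b t u) has_field_derivative u ^ Suc k * Hi_kernel b t u)
            (at t within UNIV)" for t u
      unfolding Hi_kernel_def by (auto intro!: derivative_eq_intros)
    show "(\<lambda>u. u ^ k * Hi_kernel b t u) integrable_on cbox 0 N" for t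
      using Hi_kernel_moment_integrable by simp
    show "continuous_on (UNIV \<times> cbox 0 N) (\<lambda>(t, u). u ^ Suc k * Hi_kernel b t u)"
      unfolding split_beta by (intro continuous_intros)
  qed auto
  then show ?thesis by (simp add: Hi_moment_def[abs_def])
qed

text \<open>The \<open>u\<close>-derivative of the kernel is the kernel times
  \<open>t - b^2 u - u^2\<close>; integrate it over \<open>[0, N]\<close>. The 1 is the kernel at 0,
  and the kernel at \<open>N\<close> is the truncation error.\<close>

lemma Hi_moment_ode:
  assumes "N \<ge> 0"
  shows "Hi_moment 2 b N t + b ^ 2 * Hi_moment 1 b N t - t * Hi_moment 0 b N t
           = 1 - Hi_kernel b t N"
proof -
  have "((\<lambda>u. Hi_kernel b t u * (t - b ^ 2 * u - u ^ 2)) has_integral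
          (Hi_kernel b t N - Hi_kernel b t 0)) {0..N}"
    using assms unfolding Hi_kernel_def
    by (intro fundamental_theorem_of_calculus)
       (auto simp flip: has_real_derivative_iff_has_vector_derivative
             intro!: derivative_eq_intros simp: power2_eq_square)
  moreover have I: "((\<lambda>u. u ^ k * Hi_kernel b t u) has_integral Hi_moment k b N t) {0..N}" for k
    unfolding Hi_moment_def
    by (rule integrable_integral) (rule Hi_kernel_moment_integrable)
  have "((\<lambda>u. t * (u ^ 0 * Hi_kernel b t u) - b ^ 2 * (u ^ 1 * Hi_kernel b t u)
            - u ^ 2 * Hi_kernel b t u) has_integral
          (t * Hi_moment 0 b N t - b ^ 2 * Hi_moment 1 b N t - Hi_moment 2 b N t)) {0..N}"
    by (intro has_integral_diff has_integral_mult_right I)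
  ultimately have "Hi_kernel b t N - Hi_kernel b t 0
      = t * Hi_moment 0 b N t - b ^ 2 * Hi_moment 1 b N t - Hi_moment 2 b N t"
    by (intro has_integral_unique) (auto simp: algebra_simps)
  then show ?thesis by (simp add: Hi_kernel_def)
qed

section \<open>Bounds uniform in the cutoff, and the limit of an infinite cutoff\<close>

lemma Hi_kernel_le_exp:
  assumes "u \<ge> 0"
  shows "Hi_kernel b t u \<le> exp (t * u)"
proof -
  have "0 \<le> 1 / 2 * b ^ 2 * u ^ 2" "0 \<le> 1 / 3 * u ^ 3" using assms by simp_all
  then show ?thesis unfolding Hi_kernel_def exp_le_cancel_iff by linarith
qed

lemma Hi_moment_0_le:
  assumes "s > 0" "N \<ge> 0"
  shows "Hi_moment 0 b N (- s) \<le> 1 / s"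
proof -
  have I: "((\<lambda>u. exp (- s * u)) has_integral (- exp (- s * N) / s - (- exp (- s * 0) / s))) {0..N}"
    using assms
    by (intro fundamental_theorem_of_calculus)
       (auto simp flip: has_real_derivative_iff_has_vector_derivative intro!: derivative_eq_intros)
  have "Hi_moment 0 b N (- s) \<le> integral {0..N} (\<lambda>u. exp (- s * u))"
    unfolding Hi_moment_def using Hi_kernel_le_exp[of _ b "- s"]
    by (intro integral_le Hi_kernel_moment_integrable has_integral_integrable[OF I]) auto
  also have "\<dots> \<le> 1 / s" using assms unfolding integral_unique[OF I] by simp
  finally show ?thesis .
qed

lemma Hi_moment_1_le:
  assumes "s > 0" "N \<ge> 0"
  shows "Hi_moment 1 b N (- s) \<le> 1 / s ^ 2"
proof -
  \<comment> \<open>Antiderivative of \<open>u * exp (- s * u)\<close> found by parts; its value at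
    0 produces the bound \<open>1 / s ^ 2\<close>.\<close>
  let ?P = "\<lambda>u. - (u / s + 1 / s ^ 2) * exp (- s * u)"
  have I: "((\<lambda>u. u * exp (- s * u)) has_integral (?P N - ?P 0)) {0..N}"
    using assms
    by (intro fundamental_theorem_of_calculus)
       (auto simp flip: has_real_derivative_iff_has_vector_derivative intro!: derivative_eq_intros
             simp: field_simps power2_eq_square)
  have "Hi_moment 1 b N (- s) \<le> integral {0..N} (\<lambda>u. u * exp (- s * u))"
    unfolding Hi_moment_def using Hi_kernel_le_exp[of _ b "- s"]
    by (intro integral_le Hi_kernel_moment_integrable has_integral_integrable[OF I])
       (auto intro!: mult_left_mono)
  also have "\<dots> = 1 / s ^ 2 - (N / s + 1 / s ^ 2) * exp (- s * N)"
    unfolding integral_unique[OF I] by (simp add: algebra_simps)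
  also have "\<dots> \<le> 1 / s ^ 2" using assms by simp
  finally show ?thesis .
qed

text \<open>Dominated convergence: the truncations, extended by zero, are dominated by the
  integrable kernel itself.\<close>

lemma Hi_moment_0_tendsto: "(\<lambda>n. Hi_moment 0 b (real n) t) \<longlonglongrightarrow> pi * Hi_par b t"
proof -
  let ?f = "\<lambda>n u. if u \<in> {0..real n} then Hi_kernel b t u else 0"
  have int: "Hi_kernel b t integrable_on {0..}"
    using Hi_par_integrable[of t b] by (simp add: Hi_kernel_def[abs_def])
  have fin: "Hi_kernel b t integrable_on {0..y}" for y
    using Hi_kernel_moment_integrable[of 0 b t 0 y] by simp
  have "(\<lambda>n. integral {0..} (?f n)) \<longlonglongrightarrow> integral {0..} (Hi_kernel b t)"
  proof (rule dominated_convergence(2)[OF _ int])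
    show "?f n integrable_on {0..}" for n
      using fin[of "real n"] by (simp only: integrable_restrict_Int) (simp add: Int_absorb2)
    show "norm (?f n u) \<le> Hi_kernel b t u" for n u by (simp add: Hi_kernel_nonneg)
    show "(\<lambda>n. ?f n u) \<longlonglongrightarrow> Hi_kernel b t u" if "u \<in> {0..}" for u
    proof (rule tendsto_eventually)
      obtain N where "u \<le> real N" using real_arch_simple by blast
      then show "\<forall>\<^sub>F n in sequentially. ?f n u = Hi_kernel b t u"
        using that by (intro eventually_sequentiallyI[of N]) auto
    qed
  qed
  moreover have "integral {0..} (?f n) = Hi_moment 0 b (real n) t" for n
    unfolding Henstock_Kurzweil_Integration.integral_restrict_Int
    by (simp add: Hi_moment_def Int_absorb2)
  ultimately show ?thesis by (simp add: Hi_par_def Hi_kernel_def[abs_def])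
qed

lemma Hi_moment_0_le_Hi_par: "Hi_moment 0 b (real n) t \<le> pi * Hi_par b t"
  by (rule incseq_le[OF _ Hi_moment_0_tendsto]) (auto intro!: monoI Hi_moment_mono)

text \<open>As \<open>u \<le> exp u\<close>, the extra factor \<open>u\<close> is absorbed by
  shifting \<open>t\<close> to \<open>t + 1\<close>. The bound does not depend on \<open>n\<close>,
  so the increasing first moments converge.\<close>

lemma Hi_moment_1_le_Hi_par: "Hi_moment 1 b (real n) t \<le> pi * Hi_par b (t + 1)"
proof -
  have "u * Hi_kernel b t u \<le> Hi_kernel b (t + 1) u" for u
  proof -
    have "u \<le> exp u" using exp_ge_add_one_self[of u] by linarith
    then have "u * Hi_kernel b t u \<le> exp u * Hi_kernel b t u"
      by (intro mult_right_mono Hi_kernel_nonneg)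
    then show ?thesis by (simp add: Hi_kernel_def algebra_simps flip: exp_add)
  qed
  then have "Hi_moment 1 b (real n) t \<le> Hi_moment 0 b (real n) (t + 1)"
    unfolding Hi_moment_def by (intro integral_le Hi_kernel_moment_integrable) simp
  then show ?thesis using Hi_moment_0_le_Hi_par by (rule order_trans)
qed

text \<open>This stands for pi times the derivative of \<open>Hi_par b\<close> at \<open>t\<close>.
  As a limit of truncated moments it requires no differentiation of the improper integral.\<close>

definition Hi_moment_1_lim :: "real \<Rightarrow> real \<Rightarrow> real" where
  "Hi_moment_1_lim b t = lim (\<lambda>n. Hi_moment 1 b (real n) t)"

lemma Hi_moment_1_tendsto: "(\<lambda>n. Hi_moment 1 b (real n) t) \<longlonglongrightarrow> Hi_moment_1_lim b t"
proof -
  have "incseq (\<lambda>n. Hi_moment 1 b (real n) t)" by (auto intro!: monoI Hi_moment_mono)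
  then have "convergent (\<lambda>n. Hi_moment 1 b (real n) t)"
    using Hi_moment_1_le_Hi_par incseq_convergent convergentI by metis
  then show ?thesis by (simp add: Hi_moment_1_lim_def convergent_LIMSEQ_iff)
qed

lemma Hi_par_bounds:
  assumes "s > 0"
  shows "0 \<le> pi * Hi_par b (- s)" "pi * Hi_par b (- s) \<le> 1 / s"
proof -
  show "0 \<le> pi * Hi_par b (- s)"
    by (rule LIMSEQ_le_const[OF Hi_moment_0_tendsto]) (simp add: Hi_moment_nonneg)
  show "pi * Hi_par b (- s) \<le> 1 / s"
    by (rule LIMSEQ_le_const2[OF Hi_moment_0_tendsto]) (use assms Hi_moment_0_le in auto)
qed

lemma Hi_moment_1_lim_bounds:
  assumes "s > 0"
  shows "0 \<le> Hi_moment_1_lim b (- s)" "Hi_moment_1_lim b (- s) \<le> 1 / s ^ 2"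
proof -
  show "0 \<le> Hi_moment_1_lim b (- s)"
    by (rule LIMSEQ_le_const[OF Hi_moment_1_tendsto]) (simp add: Hi_moment_nonneg)
  show "Hi_moment_1_lim b (- s) \<le> 1 / s ^ 2"
    by (rule LIMSEQ_le_const2[OF Hi_moment_1_tendsto])
       (use assms Hi_moment_1_le in \<open>auto simp del: One_nat_def\<close>)
qed

text \<open>Once \<open>n\<close> reaches \<open>3 * (\<bar>t\<bar> + 1)\<close>, the cubic term
  dominates \<open>(t + 1) * n\<close>, so the exponent is at most \<open>- n\<close>. Hence the
  error term in \<open>Hi_moment_ode\<close> disappears in the limit.\<close>

lemma Hi_kernel_tendsto_0: "(\<lambda>n. Hi_kernel b t (real n)) \<longlonglongrightarrow> 0"
proof -
  have "summable (\<lambda>n. exp (- real n))"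
    using summable_geometric[of "exp (-1 :: real)"] by (simp flip: exp_of_nat_mult)
  then have lim: "(\<lambda>n. exp (- real n)) \<longlonglongrightarrow> 0" by (rule summable_LIMSEQ_zero)
  obtain N :: nat where N: "3 * (\<bar>t\<bar> + 1) \<le> real N" using real_arch_simple by blast
  have "Hi_kernel b t (real n) \<le> exp (- real n)" if "n \<ge> N" for n
  proof -
    have n: "3 * (t + 1) \<le> real n" "1 \<le> real n" 
      using N of_nat_mono[OF that, where 'a = real] abs_ge_self[of t] abs_ge_zero[of t]
      unfolding distrib_left by linarith+
    then have "real n \<le> real n ^ 2" by (simp add: power2_eq_square)
    then have "3 * (t + 1) \<le> real n ^ 2" using n(1) by linarith
    then have "3 * (t + 1) * real n \<le> real n ^ 2 * real n" by (intro mult_right_mono) auto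
    then have "t * real n - 1 / 3 * real n ^ 3 \<le> - real n"
      by (simp add: power3_eq_cube power2_eq_square algebra_simps)
    moreover have "0 \<le> 1 / 2 * b ^ 2 * real n ^ 2" by simp
    ultimately show ?thesis unfolding Hi_kernel_def exp_le_cancel_iff by linarith
  qed
  then show ?thesis
    by (intro tendsto_sandwich[OF _ _ tendsto_const lim])
       (auto simp: Hi_kernel_nonneg eventually_sequentially)
qed

lemma Hi_kernel_mono: "s \<le> t \<Longrightarrow> u \<ge> 0 \<Longrightarrow> Hi_kernel b s u \<le> Hi_kernel b t u"
  by (simp add: Hi_kernel_def mult_right_mono)

section \<open>Antiderivatives\<close>

text \<open>The assumptions say that \<open>g\<close> solves the adjoint of the homogeneous equation
  for \<open>Hi_par\<close>. The bracket \<open>?Q N\<close> therefore has derivative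
  \<open>g\<close> up to the factor \<open>1 - Hi_kernel b t N\<close>, which tends to 1.\<close>

lemma has_integral_twisted_solution:
  fixes g h :: "real \<Rightarrow> complex"
  assumes g: "\<And>t. (g has_vector_derivative h t + b ^ 2 *\<^sub>R g t) (at t)"
    and h: "\<And>t. (h has_vector_derivative t *\<^sub>R g t) (at t)"
    and "a \<le> c"
  shows "(g has_integral
           (Hi_moment_1_lim b c *\<^sub>R g c - (pi * Hi_par b c) *\<^sub>R h c
            - (Hi_moment_1_lim b a *\<^sub>R g a - (pi * Hi_par b a) *\<^sub>R h a))) {a..c}"
proof -
  have cont_g: "continuous_on {a..c} g"
    using g by (intro continuous_on_vector_derivative) (rule has_vector_derivative_at_within)
  let ?Q = "\<lambda>N t. Hi_moment 1 b N t *\<^sub>R g t - Hi_moment 0 b N t *\<^sub>R h t"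
  have Q: "((\<lambda>t. (1 - Hi_kernel b t (real n)) *\<^sub>R g t) has_integral
             (?Q (real n) c - ?Q (real n) a)) {a..c}" for n
  proof (rule fundamental_theorem_of_calculus[OF \<open>a \<le> c\<close>])
    fix t
    let ?N = "real n"
    have "(?Q ?N has_vector_derivative
             (Hi_moment 1 b ?N t *\<^sub>R (h t + b ^ 2 *\<^sub>R g t) + Hi_moment (Suc 1) b ?N t *\<^sub>R g t
              - (Hi_moment 0 b ?N t *\<^sub>R (t *\<^sub>R g t) + Hi_moment (Suc 0) b ?N t *\<^sub>R h t))) (at t)"
      by (intro has_vector_derivative_diff has_vector_derivative_scaleR g h
            has_real_derivative_Hi_moment)
    \<comment> \<open>The two products of the first moment with \<open>h t\<close> cancel, and the
      rest is the left side of \<open>Hi_moment_ode\<close> times \<open>g t\<close>.\<close>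
    also have "(Hi_moment 1 b ?N t *\<^sub>R (h t + b ^ 2 *\<^sub>R g t) + Hi_moment (Suc 1) b ?N t *\<^sub>R g t
              - (Hi_moment 0 b ?N t *\<^sub>R (t *\<^sub>R g t) + Hi_moment (Suc 0) b ?N t *\<^sub>R h t))
        = (Hi_moment 2 b ?N t + b ^ 2 * Hi_moment 1 b ?N t - t * Hi_moment 0 b ?N t) *\<^sub>R g t"
      by (simp add: algebra_simps flip: numeral_2_eq_2)
    also have "\<dots> = (1 - Hi_kernel b t ?N) *\<^sub>R g t" by (subst Hi_moment_ode) auto
    finally show "(?Q ?N has_vector_derivative (1 - Hi_kernel b t ?N) *\<^sub>R g t)
                    (at t within {a..c})"
      by (rule has_vector_derivative_at_within)
  qed
  obtain B where B: "\<And>t. t \<in> {a..c} \<Longrightarrow> norm (g t) \<le> B"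
    using compact_imp_bounded[OF compact_continuous_image[OF cont_g compact_Icc]]
    by (fastforce simp: bounded_iff)
  \<comment> \<open>On \<open>[a, c]\<close> the kernel is largest at \<open>c\<close>, where its
    values at the cutoffs form a convergent sequence; so one \<open>K\<close> serves all
    \<open>n\<close> and \<open>t\<close>.\<close>
  obtain K where K: "\<And>n. norm (Hi_kernel b c (real n)) \<le> K"
    using convergent_imp_Bseq[OF convergentI[OF Hi_kernel_tendsto_0[of b c]]]
    by (auto simp: Bseq_def)
  have "(\<lambda>n. integral {a..c} (\<lambda>t. (1 - Hi_kernel b t (real n)) *\<^sub>R g t)) \<longlonglongrightarrow> integral {a..c} g"
  proof (rule dominated_convergence(2)[where h = "\<lambda>t. (1 + K) * B"])
    show "(\<lambda>t. (1 - Hi_kernel b t (real n)) *\<^sub>R g t) integrable_on {a..c}" for n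
      using Q by blast
    show "norm ((1 - Hi_kernel b t (real n)) *\<^sub>R g t) \<le> (1 + K) * B" if "t \<in> {a..c}" for n t
    proof -
      have "\<bar>1 - Hi_kernel b t (real n)\<bar> \<le> 1 + K"
        using Hi_kernel_mono[of t c "real n" b] K[of n] Hi_kernel_nonneg[of b t "real n"] that
        by auto
      then show ?thesis
        using B[OF that] by (auto intro!: mult_mono)
    qed
    show "(\<lambda>n. (1 - Hi_kernel b t (real n)) *\<^sub>R g t) \<longlonglongrightarrow> g t" for t
      by (auto intro!: tendsto_eq_intros Hi_kernel_tendsto_0)
  qed auto
  moreover have "(\<lambda>n. integral {a..c} (\<lambda>t. (1 - Hi_kernel b t (real n)) *\<^sub>R g t)) \<longlonglongrightarrow>
      Hi_moment_1_lim b c *\<^sub>R g c - (pi * Hi_par b c) *\<^sub>R h c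
            - (Hi_moment_1_lim b a *\<^sub>R g a - (pi * Hi_par b a) *\<^sub>R h a)"
    unfolding integral_unique[OF Q]
    by (intro tendsto_intros Hi_moment_0_tendsto Hi_moment_1_tendsto)
  ultimately have "integral {a..c} g = Hi_moment_1_lim b c *\<^sub>R g c - (pi * Hi_par b c) *\<^sub>R h c
            - (Hi_moment_1_lim b a *\<^sub>R g a - (pi * Hi_par b a) *\<^sub>R h a)"
    by (rule LIMSEQ_unique)
  then show ?thesis
    using integrable_integral[OF integrable_continuous_real[OF cont_g]] by simp
qed

text \<open>At \<open>- s\<close> the two boundary terms are O(1 / s^2) and O(1 / s) times O(sqrt
  s), so both vanish and only the upper endpoint contributes.\<close>

lemma has_integral_from_minf_twisted_solution:
  fixes g h :: "real \<Rightarrow> complex"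
  assumes g: "\<And>t. (g has_vector_derivative h t + b ^ 2 *\<^sub>R g t) (at t)"
    and h: "\<And>t. (h has_vector_derivative t *\<^sub>R g t) (at t)"
    and bound: "\<And>s. s \<ge> S \<Longrightarrow> norm (g (- s)) \<le> C" "\<And>s. s \<ge> S \<Longrightarrow> norm (h (- s)) \<le> C * sqrt s"
  shows "has_integral_from_minf g (Hi_moment_1_lim b \<zeta> *\<^sub>R g \<zeta> - (pi * Hi_par b \<zeta>) *\<^sub>R h \<zeta>) \<zeta>"
proof -
  let ?Q = "\<lambda>t. Hi_moment_1_lim b t *\<^sub>R g t - (pi * Hi_par b t) *\<^sub>R h t"
  note I = has_integral_twisted_solution[OF g h]
  have "((\<lambda>s. ?Q (- s)) \<longlongrightarrow> 0) at_top"
  proof (rule Lim_null_comparison)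
    have "((\<lambda>s. 1 / s ^ 2 * C + C * (1 / sqrt s)) \<longlongrightarrow> 0 * C + C * 0) at_top"
      by (intro tendsto_intros tendsto_divide_0[OF tendsto_const] filterlim_at_top_imp_at_infinity
            sqrt_at_top filterlim_pow_at_top filterlim_ident) auto
    then show "((\<lambda>s. 1 / s ^ 2 * C + C * (1 / sqrt s)) \<longlongrightarrow> 0) at_top" by simp
    show "\<forall>\<^sub>F s in at_top. norm (?Q (- s)) \<le> 1 / s ^ 2 * C + C * (1 / sqrt s)"
    proof (rule eventually_mono[OF eventually_ge_at_top[of "max 1 S"]])
      fix s :: real
      assume "s \<ge> max 1 S"
      then have s: "s > 0" "s \<ge> S" by auto
      have "norm (?Q (- s)) \<le> norm (Hi_moment_1_lim b (- s) *\<^sub>R g (- s))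
                                + norm ((pi * Hi_par b (- s)) *\<^sub>R h (- s))"
        by (rule norm_triangle_ineq4)
      also have "\<dots> = Hi_moment_1_lim b (- s) * norm (g (- s))
                       + pi * Hi_par b (- s) * norm (h (- s))"
        using Hi_moment_1_lim_bounds(1)[OF s(1)] Hi_par_bounds(1)[OF s(1)]
        by (simp only: norm_scaleR abs_of_nonneg)
      also have "\<dots> \<le> 1 / s ^ 2 * C + 1 / s * (C * sqrt s)"
        using s by (intro add_mono mult_mono Hi_moment_1_lim_bounds Hi_par_bounds bound) auto
      also have "1 / s * (C * sqrt s) = C * (1 / sqrt s)"
        using s by (simp add: field_simps)
      finally show "norm (?Q (- s)) \<le> 1 / s ^ 2 * C + C * (1 / sqrt s)" .
    qed
  qed
  then have "((\<lambda>R. ?Q \<zeta> - ?Q (- R)) \<longlongrightarrow> ?Q \<zeta> - 0) at_top" by (intro tendsto_intros)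
  moreover have "\<forall>\<^sub>F R in at_top. ?Q \<zeta> - ?Q (- R) = integral {- R..\<zeta>} g"
    by (rule eventually_mono[OF eventually_ge_at_top[of "- \<zeta>"]])
       (use integral_unique[OF I] in auto)
  ultimately show ?thesis
    unfolding has_integral_from_minf_def
    using I by (auto intro: Lim_transform_eventually)
qed

section \<open>Airy functions on the negative axis\<close>

text \<open>The energy \<open>?E\<close> has derivative \<open>v^2 / x^2\<close>, so to the left of
  -1 it never exceeds its value there. Both its terms are nonnegative for negative \<open>x\<close>,
  so each is bounded separately.\<close>

lemma airy_energy_bound:
  fixes u v :: "real \<Rightarrow> real"
  assumes u: "\<And>x. (u has_real_derivative v x) (at x)"
    and v: "\<And>x. (v has_real_derivative x * u x) (at x)"
    and x: "x \<le> - 1"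
  shows "(u x)\<^sup>2 \<le> (u (- 1))\<^sup>2 + (v (- 1))\<^sup>2" "(v x)\<^sup>2 \<le> ((u (- 1))\<^sup>2 + (v (- 1))\<^sup>2) * (- x)"
proof -
  let ?E = "\<lambda>x. (u x)\<^sup>2 - (v x)\<^sup>2 / x"
  have "?E x \<le> ?E (- 1)"
  proof (rule DERIV_nonneg_imp_nondecreasing[OF x])
    fix y :: real
    assume y: "y \<le> - 1"
    then have "(?E has_real_derivative (v y)\<^sup>2 / y\<^sup>2) (at y)"
      by (auto intro!: derivative_eq_intros u v simp: field_simps power2_eq_square)
    moreover have "(v y)\<^sup>2 / y\<^sup>2 \<ge> 0" by simp
    ultimately show "\<exists>d. (?E has_real_derivative d) (at y) \<and> 0 \<le> d" by blast
  qed
  then have E: "(u x)\<^sup>2 + (v x)\<^sup>2 / (- x) \<le> (u (- 1))\<^sup>2 + (v (- 1))\<^sup>2" by simp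
  moreover have "(v x)\<^sup>2 / (- x) \<ge> 0" using x by (intro divide_nonneg_pos) auto
  ultimately show "(u x)\<^sup>2 \<le> (u (- 1))\<^sup>2 + (v (- 1))\<^sup>2" by linarith
  have "(v x)\<^sup>2 / (- x) \<le> (u (- 1))\<^sup>2 + (v (- 1))\<^sup>2"
    using E zero_le_power2[of "u x"] by linarith
  then show "(v x)\<^sup>2 \<le> ((u (- 1))\<^sup>2 + (v (- 1))\<^sup>2) * (- x)"
    using x by (subst (asm) pos_divide_le_eq) auto
qed

text \<open>On the real axis the Airy equation has real coefficients, so the energy bound applies to
  the real and imaginary parts; adding the squares bounds the modulus.\<close>

lemma airy_solution_bound:
  assumes w: "\<And>z. (w has_field_derivative w' z) (at z)"
    and w': "\<And>z. (w' has_field_derivative z * w z) (at z)"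
  obtains C where "C \<ge> 0" "\<And>x. x \<le> - 1 \<Longrightarrow> norm (w (complex_of_real x)) \<le> C"
    "\<And>x. x \<le> - 1 \<Longrightarrow> norm (w' (complex_of_real x)) \<le> C * sqrt (- x)"
proof -
  note dw = has_vector_derivative_real_field[OF w]
    and dw' = has_vector_derivative_real_field[OF w']
  have Re: "((\<lambda>x. Re (w (of_real x))) has_real_derivative Re (w' (of_real x))) (at x)"
    "((\<lambda>x. Re (w' (of_real x))) has_real_derivative x * Re (w (of_real x))) (at x)" for x
    using bounded_linear.has_vector_derivative[OF bounded_linear_Re dw, of x UNIV]
      bounded_linear.has_vector_derivative[OF bounded_linear_Re dw', of x UNIV]
    by (auto simp: has_real_derivative_iff_has_vector_derivative)
  have Im: "((\<lambda>x. Im (w (of_real x))) has_real_derivative Im (w' (of_real x))) (at x)"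
    "((\<lambda>x. Im (w' (of_real x))) has_real_derivative x * Im (w (of_real x))) (at x)" for x
    using bounded_linear.has_vector_derivative[OF bounded_linear_Im dw, of x UNIV]
      bounded_linear.has_vector_derivative[OF bounded_linear_Im dw', of x UNIV]
    by (auto simp: has_real_derivative_iff_has_vector_derivative)
  define D where "D = (cmod (w (of_real (- 1))))\<^sup>2 + (cmod (w' (of_real (- 1))))\<^sup>2"
  show ?thesis
  proof (rule that[of "sqrt D"])
    show "sqrt D \<ge> 0" by (simp add: D_def)
    fix x :: real
    assume x: "x \<le> - 1"
    note E = airy_energy_bound[OF Re x] airy_energy_bound[OF Im x]
    have "(cmod (w (of_real x)))\<^sup>2 \<le> D"
      using add_mono[OF E(1,3)] by (simp add: D_def cmod_power2)
    then show "cmod (w (of_real x)) \<le> sqrt D" by (rule real_le_rsqrt)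
    have "(cmod (w' (of_real x)))\<^sup>2 \<le> D * (- x)"
      using add_mono[OF E(2,4)] by (simp add: D_def cmod_power2 algebra_simps)
    then have "cmod (w' (of_real x)) \<le> sqrt (D * (- x))" by (rule real_le_rsqrt)
    then show "cmod (w' (of_real x)) \<le> sqrt D * sqrt (- x)" by (simp only: real_sqrt_mult)
  qed
qed

lemma has_integral_from_minf_twisted_airy:
  fixes w w' :: "complex \<Rightarrow> complex" and b \<zeta> :: real
  assumes w: "\<And>z. (w has_field_derivative w' z) (at z)"
    and w': "\<And>z. (w' has_field_derivative z * w z) (at z)"
  defines "X \<equiv> \<lambda>t. complex_of_real t + of_real b ^ 4 / 4"
    and "e \<equiv> \<lambda>t. exp (of_real b ^ 2 * complex_of_real t / 2 + of_real b ^ 6 / 12)"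
  shows "has_integral_from_minf (\<lambda>t. e t * w (X t))
    (Hi_moment_1_lim b \<zeta> *\<^sub>R (e \<zeta> * w (X \<zeta>))
     - (pi * Hi_par b \<zeta>) *\<^sub>R (e \<zeta> * (w' (X \<zeta>) - of_real b ^ 2 / 2 * w (X \<zeta>)))) \<zeta>"
proof -
  let ?e = "\<lambda>z. exp (of_real b ^ 2 * z / 2 + of_real b ^ 6 / 12 :: complex)"
  let ?x = "\<lambda>z. z + of_real b ^ 4 / 4 :: complex"
  note cw = DERIV_chain'[OF _ w] and cw' = DERIV_chain'[OF _ w']
  \<comment> \<open>The exponential contributes \<open>b^2 / 2\<close> to the logarithmic
    derivative, so subtracting \<open>b^2\<close> times the function leaves \<open>- b^2 / 2\<close>
    in \<open>h\<close>.\<close>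
  have g: "((\<lambda>z. ?e z * w (?x z)) has_field_derivative
      ?e z * (w' (?x z) - of_real b ^ 2 / 2 * w (?x z)) + b ^ 2 *\<^sub>R (?e z * w (?x z))) (at z)" for z
    by (auto intro!: derivative_eq_intros cw simp: scaleR_conv_of_real algebra_simps)
  \<comment> \<open>The terms in \<open>w'\<close> cancel, and the \<open>- b^4 / 4\<close> coming
    from the exponential cancels the shift in the Airy argument, leaving the bare factor
    \<open>z\<close>.\<close>
  have h: "((\<lambda>z. ?e z * (w' (?x z) - of_real b ^ 2 / 2 * w (?x z))) has_field_derivative
      z * (?e z * w (?x z))) (at z)" for z
    by (auto intro!: derivative_eq_intros cw cw'
        simp: algebra_simps power2_eq_square power4_eq_xxxx)
  obtain C where C: "C \<ge> 0" "\<And>x. x \<le> - 1 \<Longrightarrow> norm (w (complex_of_real x)) \<le> C"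
    "\<And>x. x \<le> - 1 \<Longrightarrow> norm (w' (complex_of_real x)) \<le> C * sqrt (- x)"
    using airy_solution_bound[OF w w'] by blast
  define c where "c = exp (b ^ 6 / 12)"
  have c: "c > 0" by (simp add: c_def)
  have X: "X (- s) = complex_of_real (- s + b ^ 4 / 4)" for s by (simp add: X_def)
  have e: "cmod (e (- s)) \<le> c" if "s \<ge> 0" for s
  proof -
    have "e (- s) = complex_of_real (exp (- (b ^ 2 * s / 2) + b ^ 6 / 12))"
      by (simp add: e_def flip: exp_of_real)
    then have "cmod (e (- s)) = exp (- (b ^ 2 * s / 2) + b ^ 6 / 12)" by simp
    also have "\<dots> \<le> c" using that by (simp add: c_def)
    finally show ?thesis .
  qed
  show ?thesis
  \<comment> \<open>\<open>S\<close> pushes the shifted argument to -1 or below, where the bounds on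
    \<open>w\<close> and \<open>w'\<close> hold. The factor \<open>c\<close> bounds the exponential,
    and the remaining factor is large enough for both \<open>g\<close> and \<open>h\<close>.\<close>
  proof (rule has_integral_from_minf_twisted_solution
      [where S = "1 + b ^ 4 / 4" and C = "c * (C + b ^ 2 / 2 * C)"
         and h = "\<lambda>t. e t * (w' (X t) - of_real b ^ 2 / 2 * w (X t))"])
    show "((\<lambda>t. e t * w (X t)) has_vector_derivative
            e t * (w' (X t) - of_real b ^ 2 / 2 * w (X t)) + b ^ 2 *\<^sub>R (e t * w (X t))) (at t)" for t
      using has_vector_derivative_real_field[OF g] unfolding e_def X_def .
    show "((\<lambda>t. e t * (w' (X t) - of_real b ^ 2 / 2 * w (X t))) has_vector_derivative
            t *\<^sub>R (e t * w (X t))) (at t)" for t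
      using has_vector_derivative_real_field[OF h, of t] unfolding e_def X_def scaleR_conv_of_real .
    fix s :: real
    assume s: "s \<ge> 1 + b ^ 4 / 4"
    have "b ^ 4 / 4 \<ge> 0" by simp
    then have s': "s \<ge> 0" "s \<ge> 1" "- s + b ^ 4 / 4 \<le> - 1" "s - b ^ 4 / 4 \<le> s" using s by linarith+
    have w_le: "cmod (w (X (- s))) \<le> C" using C(2)[OF s'(3)] by (simp only: X)
    have "cmod (e (- s) * w (X (- s))) \<le> c * C"
      unfolding norm_mult using c by (intro mult_mono e w_le s') auto
    also have "\<dots> \<le> c * (C + b ^ 2 / 2 * C)" using c C(1) by (intro mult_left_mono) auto
    finally show "cmod (e (- s) * w (X (- s))) \<le> c * (C + b ^ 2 / 2 * C)" .
    have "cmod (w' (X (- s))) \<le> C * sqrt (- (- s + b ^ 4 / 4))"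
      using C(3)[OF s'(3)] by (simp only: X)
    also have "\<dots> \<le> C * sqrt s" using C(1) s' by (intro mult_left_mono real_sqrt_le_mono) auto
    finally have w'_le: "cmod (w' (X (- s))) \<le> C * sqrt s" .
    \<comment> \<open>As \<open>s\<close> is at least 1, the bounded \<open>w\<close> also fits
      under the growth rate of \<open>w'\<close>.\<close>
    have "C * 1 \<le> C * sqrt s" using s'(2) C(1) by (intro mult_left_mono) auto
    then have w_le': "cmod (w (X (- s))) \<le> C * sqrt s" using w_le by simp
    have "cmod (w' (X (- s)) - of_real b ^ 2 / 2 * w (X (- s)))
          \<le> cmod (w' (X (- s))) + cmod (of_real b ^ 2 / 2 * w (X (- s)))"
      by (rule norm_triangle_ineq4)
    also have "\<dots> = cmod (w' (X (- s))) + b ^ 2 / 2 * cmod (w (X (- s)))"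
      by (simp add: norm_mult norm_divide norm_power)
    also have "\<dots> \<le> C * sqrt s + b ^ 2 / 2 * (C * sqrt s)"
      by (intro add_mono mult_left_mono w'_le w_le') auto
    finally have "cmod (w' (X (- s)) - of_real b ^ 2 / 2 * w (X (- s)))
        \<le> C * sqrt s + b ^ 2 / 2 * (C * sqrt s)" .
    then have "cmod (e (- s) * (w' (X (- s)) - of_real b ^ 2 / 2 * w (X (- s))))
        \<le> c * (C * sqrt s + b ^ 2 / 2 * (C * sqrt s))"
      unfolding norm_mult using c by (intro mult_mono e s') auto
    then show "cmod (e (- s) * (w' (X (- s)) - of_real b ^ 2 / 2 * w (X (- s))))
        \<le> c * (C + b ^ 2 / 2 * C) * sqrt s"
      by (simp add: algebra_simps)
  qed
qed

section \<open>The Wronskian\<close>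

text \<open>The Airy equation has no first-order term, so the derivative of the Wronskian
  vanishes.\<close>

lemma airy_wronskian:
  assumes p: "\<And>z. (p has_field_derivative p' z) (at z)" "\<And>z. (p' has_field_derivative z * p z) (at z)"
    and q: "\<And>z. (q has_field_derivative q' z) (at z)" "\<And>z. (q' has_field_derivative z * q z) (at z)"
  shows "p z * q' z - p' z * q z = p 0 * q' 0 - p' 0 * (q 0 :: complex)"
proof -
  have "((\<lambda>z. p z * q' z - p' z * q z) has_field_derivative 0) (at x)" for x
    by (auto intro!: derivative_eq_intros p q simp: algebra_simps)
  then show ?thesis
    using has_field_derivative_zero_constant[of UNIV "\<lambda>z. p z * q' z - p' z * q z"]
    by (metis UNIV_I convex_UNIV)
qed

text \<open>Reflection formula at 1/3, with sin(pi / 3) = sqrt 3 / 2.\<close>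

lemma Gamma_third_mult: "Gamma (1 / 3) * Gamma (2 / 3) = 2 * pi / sqrt 3"
proof -
  have "Gamma (complex_of_real (1 / 3)) * Gamma (complex_of_real (2 / 3))
          = of_real pi / sin (of_real (pi * (1 / 3)))"
    using Gamma_reflection_complex[of "complex_of_real (1 / 3)"] by simp
  also have "\<dots> = of_real (pi / sin (pi * (1 / 3)))" by (simp only: sin_of_real of_real_divide)
  also have "sin (pi * (1 / 3)) = sqrt 3 / 2" using sin_60 by simp
  finally have "complex_of_real (Gamma (1 / 3) * Gamma (2 / 3)) = of_real (pi / (sqrt 3 / 2))"
    by (simp only: Gamma_complex_of_real of_real_mult)
  then show ?thesis by (subst (asm) of_real_eq_iff) simp
qed

text \<open>The left side is Ai(0) Bi'(0) - Ai'(0) Bi(0) in terms of the prescribed initial values.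
  Once the powers of 3 are combined, each of the two terms contributes 1 / (2 pi).\<close>

lemma Airy_wronskian_at_0:
  "1 / (3 powr (2 / 3) * Gamma (2 / 3)) * (3 powr (1 / 6) / Gamma (1 / 3))
     - - 1 / (3 powr (1 / 3) * Gamma (1 / 3)) * (1 / (3 powr (1 / 6) * Gamma (2 / 3))) = 1 / pi"
    (is "?L = _")
proof -
  have G: "Gamma (1 / 3 :: real) > 0" "Gamma (2 / 3 :: real) > 0" by (simp_all add: Gamma_real_pos)
  have s: "3 powr (1 / 2) = sqrt 3" by (simp add: powr_half_sqrt)
  have p: "3 powr (2 / 3) = sqrt 3 * 3 powr (1 / 6 :: real)"
    "3 powr (1 / 3) * 3 powr (1 / 6) = sqrt 3"
    unfolding s[symmetric] by (simp_all flip: powr_add)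
  have "?L = 1 / (sqrt 3 * (Gamma (1 / 3) * Gamma (2 / 3)))
             + 1 / (3 powr (1 / 3) * 3 powr (1 / 6) * (Gamma (1 / 3) * Gamma (2 / 3)))"
    unfolding p(1) using G by (simp add: field_simps)
  also have "\<dots> = 1 / pi" unfolding p(2) Gamma_third_mult by simp
  finally show ?thesis .
qed

section \<open>Assembling the identity from Ai and Bi\<close>

lemma Airy_Ai_ivp:
  "airy_ivp (of_real (1 / (3 powr (2 / 3) * Gamma (2 / 3))))
            (of_real (- 1 / (3 powr (1 / 3) * Gamma (1 / 3)))) Airy_Ai"
  unfolding Airy_Ai_def by (rule theI'[OF airy_ivp_ex1])

lemma Airy_Bi_ivp:
  "airy_ivp (of_real (1 / (3 powr (1 / 6) * Gamma (2 / 3))))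
            (of_real (3 powr (1 / 6) / Gamma (1 / 3))) Airy_Bi"
  unfolding Airy_Bi_def by (rule theI'[OF airy_ivp_ex1])

theorem lemma2p3:
  fixes b \<zeta> :: real
  shows "(\<exists>I. has_integral_from_minf (\<lambda>t. Ai_par (of_real b) (of_real t)) I \<zeta>) \<and>
         (\<exists>I. has_integral_from_minf (\<lambda>t. Bi_par (of_real b) (of_real t)) I \<zeta>) \<and>
         complex_of_real (Hi_par b \<zeta>) =
           Bi_par (\<i> * of_real b) (of_real \<zeta>)
             * integral_from_minf (\<lambda>t. Ai_par (of_real b) (of_real t)) \<zeta>
         - Ai_par (\<i> * of_real b) (of_real \<zeta>)
             * integral_from_minf (\<lambda>t. Bi_par (of_real b) (of_real t)) \<zeta>"
proof -
  obtain A' where A: "\<And>z. (Airy_Ai has_field_derivative A' z) (at z)"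
    "\<And>z. (A' has_field_derivative z * Airy_Ai z) (at z)"
    "Airy_Ai 0 = of_real (1 / (3 powr (2 / 3) * Gamma (2 / 3)))"
    "A' 0 = of_real (- 1 / (3 powr (1 / 3) * Gamma (1 / 3)))"
    using Airy_Ai_ivp unfolding airy_ivp_def by blast
  obtain B' where B: "\<And>z. (Airy_Bi has_field_derivative B' z) (at z)"
    "\<And>z. (B' has_field_derivative z * Airy_Bi z) (at z)"
    "Airy_Bi 0 = of_real (1 / (3 powr (1 / 6) * Gamma (2 / 3)))"
    "B' 0 = of_real (3 powr (1 / 6) / Gamma (1 / 3))"
    using Airy_Bi_ivp unfolding airy_ivp_def by blast
  have W: "Airy_Ai z * B' z - A' z * Airy_Bi z = of_real (1 / pi)" for z
    unfolding airy_wronskian[OF A(1,2) B(1,2)] A(3,4) B(3,4) Airy_wronskian_at_0[symmetric]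
    by (simp only: of_real_mult of_real_diff)
  note IA = has_integral_from_minf_twisted_airy[OF A(1,2), of b \<zeta>, folded Ai_par_def]
    and IB = has_integral_from_minf_twisted_airy[OF B(1,2), of b \<zeta>, folded Bi_par_def]
  define x where "x = complex_of_real \<zeta> + of_real b ^ 4 / 4"
  define e where "e = exp (of_real b ^ 2 * complex_of_real \<zeta> / 2 + of_real b ^ 6 / 12)"
  define f where "f = exp ((\<i> * of_real b) ^ 2 * complex_of_real \<zeta> / 2 + (\<i> * of_real b) ^ 6 / 12)"
  define m where "m = complex_of_real (Hi_moment_1_lim b \<zeta>)"
  define r where "r = complex_of_real b ^ 2 / 2"
  \<comment> \<open>The fourth power is unchanged, so \<open>b\<close> and \<open>\<i> * b\<close>
    share the Airy argument \<open>x\<close>; the second and sixth powers change sign, so the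
    prefactors \<open>f\<close> and \<open>e\<close> are reciprocal.\<close>
  have i_pow: "(\<i> * of_real b) ^ 2 = - (of_real b ^ 2 :: complex)"
    "(\<i> * of_real b) ^ 4 = (of_real b ^ 4 :: complex)"
    "(\<i> * of_real b) ^ 6 = - (of_real b ^ 6 :: complex)"
    by (simp_all add: power_mult_distrib)
  have ef: "f * e = 1" by (simp add: f_def e_def i_pow flip: exp_add)
  have pars: "Ai_par (\<i> * of_real b) (of_real \<zeta>) = f * Airy_Ai x"
    "Bi_par (\<i> * of_real b) (of_real \<zeta>) = f * Airy_Bi x"
    by (simp_all add: Ai_par_def Bi_par_def f_def x_def i_pow)
  have vA: "integral_from_minf (\<lambda>t. Ai_par (of_real b) (of_real t)) \<zeta>
      = m * (e * Airy_Ai x) - of_real (pi * Hi_par b \<zeta>) * (e * (A' x - r * Airy_Ai x))"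
    using integral_from_minf_eq[OF IA]
    by (simp add: Ai_par_def m_def e_def x_def r_def scaleR_conv_of_real)
  have vB: "integral_from_minf (\<lambda>t. Bi_par (of_real b) (of_real t)) \<zeta>
      = m * (e * Airy_Bi x) - of_real (pi * Hi_par b \<zeta>) * (e * (B' x - r * Airy_Bi x))"
    using integral_from_minf_eq[OF IB]
    by (simp add: Bi_par_def m_def e_def x_def r_def scaleR_conv_of_real)
  \<comment> \<open>The terms with \<open>m\<close> and \<open>r\<close> are symmetric in Ai and Bi
    and cancel; what survives is the Wronskian, whose value \<open>1 / pi\<close> removes the factor
    \<open>pi\<close>.\<close>
  have "f * Airy_Bi x * (m * (e * Airy_Ai x) - of_real (pi * Hi_par b \<zeta>) * (e * (A' x - r * Airy_Ai x)))
      - f * Airy_Ai x * (m * (e * Airy_Bi x) - of_real (pi * Hi_par b \<zeta>) * (e * (B' x - r * Airy_Bi x)))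
      = f * e * of_real (pi * Hi_par b \<zeta>) * (Airy_Ai x * B' x - A' x * Airy_Bi x)"
    by (simp add: algebra_simps)
  also have "\<dots> = of_real (Hi_par b \<zeta>)" by (simp add: ef W)
  finally show ?thesis
    using IA IB unfolding pars vA vB by auto
qed

end
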